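(* There is an absolute constant $C>0$ such that the following holds. Let $L>0$, $n\ge 1$, and let $f(\cdot;1),\dots,f(\cdot;n):\mathbb{R}^d\to\mathbb{R}$ be convex differentiable functions such that $\|\nabla f(x;i)-\nabla f(y;i)\|\le L\|x-y\|$ for all $x,y\in\mathbb{R}^d$ and $i\in\{1,\dots,n\}$. Let $F(w)=\frac1n\sum_{i=1}^n f(w;i)$, assume $F$ has a minimizer, let $x_*$ be any minimizer of $F$, and let $\sigma_*^2=\frac1n\sum_{i=1}^n\|\nabla f(x_*;i)\|^2$. Let $\epsilon>0$ and $\tilde x_0\in\mathbb{R}^d$. Then the number $nT$ of individual gradient evaluations needed by the NASG algorithm started at $\tilde y_0=\tilde x_0$ (with arbitrary permutations in each epoch, $\gamma_t=\frac{t-1}{t+2}$, $\eta_i^{(t)}=\frac{\eta_t}{n}$, $\eta_t=\frac{k\alpha^t}{LT}\le\frac1L$, $k=\frac{1}{e\alpha\sqrt[3]{12}}$, $\alpha=1+\frac1T$) to reach a point $x$ with $F(x)-F(x_* )\le\epsilon$ is $$nT=\mathcal{O}\left(\frac{n\sigma_*^2}{L\epsilon}+\frac{nL\|\tilde x_0-x_*\|^2}{\epsilon}\right),$$ in the sense that whenever the number of epochs is an integer $T\ge 2$ with $nT\ge C\left(\frac{n\sigma_*^2}{L\epsilon}+\frac{nL\|\tilde x_0-x_*\|^2}{\epsilon}\right)$, the output satisfies $F(\tilde x_T)-F(x_* )\le\epsilon$.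
   Context: NASG (Nesterov Accelerated Shuffling Gradient) algorithm: given initial points $\tilde x_0,\tilde y_0\in\mathbb{R}^d$, parameters $\gamma_t$ and learning rates $\eta_i^{(t)}>0$, for each epoch $t=1,2,\dots,T$: set $y_0^{(t)}:=\tilde y_{t-1}$; choose a permutation $\pi^{(t)}$ of $\{1,\dots,n\}$ (deterministic or random); for $i=1,\dots,n$ set $y_i^{(t)}:=y_{i-1}^{(t)}-\eta_i^{(t)}\nabla f(y_{i-1}^{(t)};\pi^{(t)}(i))$; then set $\tilde x_t:=y_n^{(t)}$ and $\tilde y_t:=\tilde x_t+\gamma_t(\tilde x_t-\tilde x_{t-1})$. The algorithm uses $n$ individual gradient evaluations per epoch, hence $nT$ in total. Here $e$ is Euler's number. *)

theory Defs
  imports "HOL-Analysis.Analysis"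
begin

text \<open>
  The constant in the theorem is absolute, so in particular it does not depend on the dimension
  \<open>d\<close>, and \<open>d\<close> has to be quantified inside the formula. A type such as
  \<open>real ^ 'd\<close> does not allow this. All spaces \<open>\<real>\<^sup>d\<close> are therefore realised as the coordinate
  subspaces \<open>rn d\<close> of one inner product space: the finitely supported real sequences with the
  inner product \<open>\<Sum>i. x i * y i\<close>. Coordinates are numbered from 0.
\<close>

typedef fseq = "{x :: nat \<Rightarrow> real. finite {i. x i \<noteq> 0}}"
  morphisms coord Abs_fseq
  by (rule exI[of _ "\<lambda>_. 0"]) simp

setup_lifting type_definition_fseq

lemma finite_support: "finite {i. coord x i \<noteq> 0}"
  using coord[of x] by simp

lemma fseq_eqI: "(\<And>i. coord x i = coord y i) \<Longrightarrow> x = y"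
  by (simp add: coord_inject[symmetric] fun_eq_iff)

instantiation fseq :: real_vector
begin

lift_definition zero_fseq :: fseq is "\<lambda>_. 0" by simp

lift_definition plus_fseq :: "fseq \<Rightarrow> fseq \<Rightarrow> fseq" is "\<lambda>x y i. x i + y i"
  subgoal for x y
    by (rule finite_subset[of _ "{i. x i \<noteq> 0} \<union> {i. y i \<noteq> 0}"]) auto
  done

lift_definition uminus_fseq :: "fseq \<Rightarrow> fseq" is "\<lambda>x i. - x i" by simp

lift_definition minus_fseq :: "fseq \<Rightarrow> fseq \<Rightarrow> fseq" is "\<lambda>x y i. x i - y i"
  subgoal for x y
    by (rule finite_subset[of _ "{i. x i \<noteq> 0} \<union> {i. y i \<noteq> 0}"]) auto
  done

lift_definition scaleR_fseq :: "real \<Rightarrow> fseq \<Rightarrow> fseq" is "\<lambda>c x i. c * x i"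
  subgoal for c x
    by (rule finite_subset[of _ "{i. x i \<noteq> 0}"]) auto
  done

instance
  by standard (transfer; simp add: fun_eq_iff algebra_simps)+

end

lemmas coord_simps [simp] =
  zero_fseq.rep_eq plus_fseq.rep_eq uminus_fseq.rep_eq minus_fseq.rep_eq scaleR_fseq.rep_eq

instantiation fseq :: real_inner
begin

definition inner_fseq :: "fseq \<Rightarrow> fseq \<Rightarrow> real" where
  "inner_fseq x y = (\<Sum>i | coord x i \<noteq> 0. coord x i * coord y i)"

definition norm_fseq :: "fseq \<Rightarrow> real" where
  "norm_fseq x = sqrt (inner x x)"

definition dist_fseq :: "fseq \<Rightarrow> fseq \<Rightarrow> real" where
  "dist_fseq x y = norm (x - y)"

definition sgn_fseq :: "fseq \<Rightarrow> fseq" where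
  "sgn_fseq x = x /\<^sub>R norm x"

definition uniformity_fseq :: "(fseq \<times> fseq) filter" where
  "uniformity_fseq = (INF e\<in>{0<..}. principal {(x, y). dist x y < e})"

definition open_fseq :: "fseq set \<Rightarrow> bool" where
  "open_fseq U \<longleftrightarrow> (\<forall>x\<in>U. eventually (\<lambda>(x', y). x' = x \<longrightarrow> y \<in> U) uniformity)"

lemma inner_fseq_sum:
  assumes "finite A" "{i. coord x i \<noteq> 0} \<subseteq> A"
  shows "inner x y = (\<Sum>i\<in>A. coord x i * coord y i)"
  unfolding inner_fseq_def by (rule sum.mono_neutral_left) (use assms in auto)

instance
proof
  fix x y z :: fseq and r :: real
  let ?A = "{i. coord x i \<noteq> 0} \<union> {i. coord y i \<noteq> 0}"
  have A: "finite ?A" by (simp add: finite_support)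
  show "inner x y = inner y x"
    using inner_fseq_sum[OF A, of x y] inner_fseq_sum[OF A, of y x] by (simp add: mult.commute)
  show "inner (x + y) z = inner x z + inner y z"
    using inner_fseq_sum[OF A, of "x + y" z] inner_fseq_sum[OF A, of x z] inner_fseq_sum[OF A, of y z]
    by (auto simp: distrib_right sum.distrib subset_iff)
  show "inner (r *\<^sub>R x) y = r * inner x y"
    using inner_fseq_sum[OF A, of "r *\<^sub>R x" y] inner_fseq_sum[OF A, of x y]
    by (auto simp: sum_distrib_left mult.assoc subset_iff)
  show "0 \<le> inner x x"
    unfolding inner_fseq_def by (simp add: sum_nonneg)
  have "inner x x = 0 \<longleftrightarrow> (\<forall>i\<in>{i. coord x i \<noteq> 0}. coord x i * coord x i = 0)"
    unfolding inner_fseq_def by (rule sum_nonneg_eq_0_iff) (auto simp: finite_support)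
  also have "\<dots> \<longleftrightarrow> x = 0"
    by (auto intro: fseq_eqI)
  finally show "inner x x = 0 \<longleftrightarrow> x = 0" .
qed (simp_all add: norm_fseq_def dist_fseq_def sgn_fseq_def uniformity_fseq_def open_fseq_def)

end

definition rn :: "nat \<Rightarrow> fseq set" where
  "rn d = {x. \<forall>i\<ge>d. coord x i = 0}"

lemma subspace_rn: "subspace (rn d)"
  by (auto simp: rn_def subspace_def)

lemma rn_tuple: "\<exists>!x. x \<in> rn d \<and> (\<forall>i<d. coord x i = a i)"
proof
  let ?a = "\<lambda>i. if i < d then a i else 0"
  have "finite {i. ?a i \<noteq> 0}"
    by (rule finite_subset[of _ "{..<d}"]) auto
  then have ca: "coord (Abs_fseq ?a) = ?a"
    by (intro Abs_fseq_inverse) simp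
  show "Abs_fseq ?a \<in> rn d \<and> (\<forall>i<d. coord (Abs_fseq ?a) i = a i)"
    by (simp add: rn_def ca)
  show "x = Abs_fseq ?a" if "x \<in> rn d \<and> (\<forall>i<d. coord x i = a i)" for x
  proof (rule fseq_eqI)
    show "coord x i = coord (Abs_fseq ?a) i" for i
      using that by (cases "i < d") (auto simp: rn_def ca)
  qed
qed

lemma inner_rn: "x \<in> rn d \<Longrightarrow> inner x y = (\<Sum>i<d. coord x i * coord y i)"
  by (rule inner_fseq_sum) (auto simp: rn_def intro: leI)

lemma norm_rn: "x \<in> rn d \<Longrightarrow> norm x = L2_set (coord x) {..<d}"
  by (simp add: norm_fseq_def inner_rn L2_set_def power2_eq_square)

text \<open>
  The gradient of \<open>f\<close> as a function on the subspace \<open>S\<close>; the values of \<open>f\<close> outside \<open>S\<close> are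
  irrelevant. On \<open>rn d\<close> it exists and is unique wherever \<open>f\<close> is differentiable.
\<close>

definition grad_on :: "'a::real_inner set \<Rightarrow> ('a \<Rightarrow> real) \<Rightarrow> 'a \<Rightarrow> 'a" where
  "grad_on S f x = (THE g. g \<in> S \<and> (f has_derivative (\<lambda>h. inner g h)) (at x within S))"

lemma grad_on_rn:
  assumes f: "f differentiable (at x within rn d)" and x: "x \<in> rn d"
  shows "\<exists>!g. g \<in> rn d \<and> (f has_derivative (\<lambda>h. inner g h)) (at x within rn d)"
proof -
  obtain D where D: "(f has_derivative D) (at x within rn d)"
    using f by (auto simp: differentiable_def)
  then have lin: "linear D" by (rule has_derivative_linear)
  define e where "e i = Abs_fseq (\<lambda>j. if j = i then 1 else 0)" for i :: nat
  have e: "coord (e i) j = (if j = i then 1 else 0)" for i j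
  proof -
    have "finite {j. (if j = i then 1 else 0 :: real) \<noteq> 0}"
      by (rule finite_subset[of _ "{i}"]) auto
    then show ?thesis by (simp add: e_def Abs_fseq_inverse)
  qed
  have coord_sum: "coord (sum g A) j = (\<Sum>i\<in>A. coord (g i) j)"
    for g :: "nat \<Rightarrow> fseq" and A j
    by (induction A rule: infinite_finite_induct) auto
  define g where "g = (\<Sum>i<d. D (e i) *\<^sub>R e i)"
  have cg: "coord g j = (if j < d then D (e j) else 0)" for j
    by (simp add: g_def coord_sum e if_distrib[of "(*) _"] cong: if_cong)
  have g: "g \<in> rn d" by (simp add: rn_def cg)
  have Dg: "D h = inner g h" if h: "h \<in> rn d" for h
  proof -
    have h_eq: "h = (\<Sum>i<d. coord h i *\<^sub>R e i)"
      using h by (intro fseq_eqI)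
        (auto simp: coord_sum e rn_def if_distrib[of "(*) _"] cong: if_cong)
    have "D h = (\<Sum>i<d. D (coord h i *\<^sub>R e i))"
      by (subst h_eq) (rule linear_sum[OF lin])
    also have "\<dots> = (\<Sum>i<d. coord h i *\<^sub>R D (e i))"
      by (simp add: linear_scale[OF lin])
    also have "\<dots> = inner g h"
      by (simp add: inner_rn[OF g] cg mult.commute)
    finally show ?thesis .
  qed
  have fg: "(f has_derivative (\<lambda>h. inner g h)) (at x within rn d)"
    unfolding has_derivative_within
  proof
    show "bounded_linear (inner g)" by (rule bounded_linear_inner_right)
    have "((\<lambda>y. (1 / norm (y - x)) *\<^sub>R (f y - (f x + D (y - x)))) \<longlongrightarrow> 0) (at x within rn d)"
      using D by (simp add: has_derivative_within)
    then show "((\<lambda>y. (1 / norm (y - x)) *\<^sub>R (f y - (f x + inner g (y - x)))) \<longlongrightarrow> 0)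
        (at x within rn d)"
      by (rule Lim_transform_eventually)
        (auto simp: eventually_at_filter Dg subspace_diff[OF subspace_rn] x)
  qed
  have "g' = g" if g': "g' \<in> rn d" "(f has_derivative (\<lambda>h. inner g' h)) (at x within rn d)" for g'
  proof -
    define u where "u = g' - g"
    have u: "x + t *\<^sub>R u \<in> rn d" for t
      using g g' x by (simp add: u_def subspace_rn subspace_add subspace_scale subspace_diff)
    have *: "((\<lambda>t. f (x + t *\<^sub>R u)) has_derivative (\<lambda>t. inner k (t *\<^sub>R u))) (at 0)"
      if "(f has_derivative (\<lambda>h. inner k h)) (at x within rn d)" for k
    proof -
      have "((\<lambda>t::real. x + t *\<^sub>R u) has_derivative (\<lambda>t. t *\<^sub>R u)) (at 0)"
        by (auto intro!: derivative_eq_intros)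
      then show ?thesis
      proof (rule has_derivative_in_compose)
        show "(f has_derivative inner k) (at (x + 0 *\<^sub>R u) within range (\<lambda>t. x + t *\<^sub>R u))"
          using has_derivative_subset[OF that, of "range (\<lambda>t. x + t *\<^sub>R u)"] u by auto
      qed
    qed
    have "(\<lambda>t. inner g' (t *\<^sub>R u)) = (\<lambda>t. inner g (t *\<^sub>R u))"
      by (rule has_derivative_unique[OF *[OF g'(2)] *[OF fg]])
    then have "inner g' u = inner g u" by (auto dest: fun_cong[of _ _ 1])
    then have "inner u u = 0" by (simp add: u_def inner_diff_left)
    then show ?thesis by (simp add: u_def)
  qed
  then show ?thesis using g fg by blast
qed

text \<open>
  In the two functions below \<open>G i w\<close> stands for \<open>\<nabla>f(w;i)\<close>, and \<open>nasg\<dots> t\<close> is the pair of the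
  iterates \<open>x\<close> and \<open>y\<close> (with tildes) after epoch \<open>t\<close>; epochs, inner steps and components are
  numbered from 1.
\<close>

fun nasg_epoch ::
  "(nat \<Rightarrow> 'a \<Rightarrow> 'a::real_vector) \<Rightarrow> (nat \<Rightarrow> nat) \<Rightarrow> (nat \<Rightarrow> real) \<Rightarrow> 'a \<Rightarrow> nat \<Rightarrow> 'a"
where
  "nasg_epoch G p eta y 0 = y"
| "nasg_epoch G p eta y (Suc i) =
     nasg_epoch G p eta y i - eta (Suc i) *\<^sub>R G (p (Suc i)) (nasg_epoch G p eta y i)"

fun nasg ::
  "nat \<Rightarrow> (nat \<Rightarrow> 'a \<Rightarrow> 'a::real_vector) \<Rightarrow> (nat \<Rightarrow> nat \<Rightarrow> nat) \<Rightarrow> (nat \<Rightarrow> real) \<Rightarrow>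
   (nat \<Rightarrow> nat \<Rightarrow> real) \<Rightarrow> 'a \<Rightarrow> 'a \<Rightarrow> nat \<Rightarrow> 'a \<times> 'a"
where
  "nasg n G \<pi> \<gamma> \<eta> x0 y0 0 = (x0, y0)"
| "nasg n G \<pi> \<gamma> \<eta> x0 y0 (Suc t) =
     (let (x, y) = nasg n G \<pi> \<gamma> \<eta> x0 y0 t;
          x' = nasg_epoch G (\<pi> (Suc t)) (\<eta> (Suc t)) y n
      in (x', x' + \<gamma> (Suc t) *\<^sub>R (x' - x)))"

definition momentum :: "nat \<Rightarrow> real" where
  "momentum t = (real t - 1) / (real t + 2)"

definition epoch_rate :: "real \<Rightarrow> nat \<Rightarrow> nat \<Rightarrow> real" where
  "epoch_rate L T t =
     (let \<alpha> = 1 + 1 / real T; k = 1 / (exp 1 * \<alpha> * root 3 12)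
      in k * \<alpha> ^ t / (L * real T))"

text \<open>The condition \<open>\<eta>\<^sub>t \<le> 1/L\<close> imposed on the learning rates holds automatically.\<close>

lemma epoch_rate_le:
  assumes "L > 0" "T \<ge> 1" "t \<le> T"
  shows "epoch_rate L T t \<le> 1 / L"
proof -
  define \<alpha> where "\<alpha> = 1 + 1 / real T"
  have \<alpha>: "\<alpha> \<ge> 1" by (simp add: \<alpha>_def)
  have r: "root 3 12 \<ge> (1::real)" by simp
  have "\<alpha> ^ t \<le> \<alpha> ^ T" using \<alpha> assms by (simp add: power_increasing)
  also have "\<dots> \<le> exp (1 / real T) ^ T"
    unfolding \<alpha>_def by (intro power_mono exp_ge_add_one_self) auto
  also have "\<dots> = exp 1"
    using assms by (simp add: exp_of_nat_mult[symmetric])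
  finally have "\<alpha> ^ t \<le> exp 1 * 1 * 1" by simp
  also have "\<dots> \<le> exp 1 * \<alpha> * root 3 12"
    using \<alpha> r by (intro mult_mono) auto
  finally have "\<alpha> ^ t \<le> exp 1 * \<alpha> * root 3 12" .
  moreover have "0 < exp 1 * \<alpha> * root 3 12"
    using \<alpha> r by (intro mult_pos_pos) auto
  ultimately have "1 / (exp 1 * \<alpha> * root 3 12) * \<alpha> ^ t \<le> 1"
    by (simp only: times_divide_eq_left mult_1 divide_le_eq_1_pos)
  then have "1 / (exp 1 * \<alpha> * root 3 12) * \<alpha> ^ t / (L * real T) \<le> 1 / (L * real T)"
    using assms by (intro divide_right_mono) auto
  also have "\<dots> \<le> 1 / L"
    using assms by (intro divide_left_mono) auto
  finally show ?thesis by (simp add: epoch_rate_def Let_def \<alpha>_def)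
qed

definition avg :: "nat \<Rightarrow> (nat \<Rightarrow> 'a \<Rightarrow> real) \<Rightarrow> 'a \<Rightarrow> real" where
  "avg n f w = (\<Sum>i=1..n. f i w) / real n"

end

theory Submission
  imports Defs
begin

text \<open>
  An epoch is a perturbed Nesterov step on the average \<open>F\<close>: it moves from \<open>y\<close> along a direction
  \<open>g\<close> that, the inner steps being short, differs from \<open>\<nabla>F(y)\<close> by at most
  \<open>4/3 \<eta>L (\<sigma> + L \<parallel>y - x\<^sub>*\<parallel>)\<close>. With \<open>z\<^sub>t = ((t + 2) y\<^sub>t - t x\<^sub>t) / 2\<close>
  the potential
  \<open>E\<^sub>t = \<eta>\<^sub>t t(t + 2)/4 (F(x\<^sub>t) - F(x\<^sub>*)) + \<parallel>z\<^sub>t - x\<^sub>*\<parallel>\<^sup>2/2\<close>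
  of the exact method grows per epoch only by the factor \<open>1 + 1/T\<close> (from
  \<open>\<eta>\<^sub>t\<^sub>+\<^sub>1 = (1 + 1/T) \<eta>\<^sub>t\<close>) and the noise term
  \<open>(\<sigma>/L + \<parallel>y - x\<^sub>*\<parallel>) \<parallel>z - x\<^sub>*\<parallel> / (2T)\<close>, because \<open>\<eta>L\<close> is of order
  \<open>1/T\<close>. All points \<open>x\<^sub>t\<close>, \<open>y\<^sub>t\<close> are convex combinations of the \<open>z\<^sub>s\<close>, so a discrete
  Gronwall argument bounds \<open>E\<^sub>T\<close> by
  \<open>e\<^sup>6 (\<parallel>x\<^sub>0 - x\<^sub>*\<parallel>\<^sup>2 + \<sigma>\<^sup>2/L\<^sup>2)\<close>, while the weight of
  \<open>F(x\<^sub>T) - F(x\<^sub>*)\<close> in \<open>E\<^sub>T\<close> is at least \<open>T/(36L)\<close>.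
\<close>

section \<open>Single-step inequalities: tangent, descent, potential and noise\<close>

text \<open>The derivative is taken within \<open>S\<close> only. A line with base point and
  direction in \<open>S\<close> never leaves \<open>S\<close>, so along it an ordinary two-sided
  derivative results.\<close>

lemma has_real_derivative_along_line:
  fixes f :: "'a::real_inner \<Rightarrow> real"
  assumes S: "subspace S" "x \<in> S" "v \<in> S"
    and D: "(f has_derivative (\<lambda>h. inner g h)) (at (x + t *\<^sub>R v) within S)"
  shows "((\<lambda>t. f (x + t *\<^sub>R v)) has_real_derivative inner g v) (at t)"
proof -
  have "((\<lambda>t::real. x + t *\<^sub>R v) has_derivative (\<lambda>t. t *\<^sub>R v)) (at t)"
    by (auto intro!: derivative_eq_intros)
  moreover have "(f has_derivative inner g) (at (x + t *\<^sub>R v) within range (\<lambda>t. x + t *\<^sub>R v))"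
    by (rule has_derivative_subset[OF D]) (use S in \<open>auto simp: subspace_add subspace_scale\<close>)
  ultimately have "((\<lambda>t. f (x + t *\<^sub>R v)) has_derivative (\<lambda>t. inner g (t *\<^sub>R v))) (at t)"
    by (rule has_derivative_in_compose)
  then show ?thesis
    by (simp add: has_field_derivative_def mult.commute[of _ "inner g v"])
qed

text \<open>Restriction to the line through \<open>x\<close> and \<open>y\<close> reduces this to
  the tangent inequality for convex functions of one real variable.\<close>

lemma convex_on_above_tangent_subspace:
  fixes f :: "'a::real_inner \<Rightarrow> real"
  assumes S: "subspace S" "x \<in> S" "y \<in> S" and f: "convex_on S f"
    and D: "(f has_derivative (\<lambda>h. inner g h)) (at x within S)"
  shows "f x + inner g (y - x) \<le> f y"
proof -
  define v where "v = y - x"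
  have v: "v \<in> S" using S by (simp add: v_def subspace_diff)
  have "convex_on UNIV (\<lambda>t. f (x + t *\<^sub>R v))"
  proof (rule convex_onI)
    fix t a b :: real
    assume t: "0 < t" "t < 1"
    have "f ((1 - t) *\<^sub>R (x + a *\<^sub>R v) + t *\<^sub>R (x + b *\<^sub>R v))
        \<le> (1 - t) * f (x + a *\<^sub>R v) + t * f (x + b *\<^sub>R v)"
      by (rule convex_onD[OF f]) (use t S v in \<open>auto simp: subspace_add subspace_scale\<close>)
    also have "(1 - t) *\<^sub>R (x + a *\<^sub>R v) + t *\<^sub>R (x + b *\<^sub>R v)
        = x + ((1 - t) *\<^sub>R a + t *\<^sub>R b) *\<^sub>R v"
      by (simp add: algebra_simps)
    finally show "f (x + ((1 - t) *\<^sub>R a + t *\<^sub>R b) *\<^sub>R v)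
        \<le> (1 - t) * f (x + a *\<^sub>R v) + t * f (x + b *\<^sub>R v)" .
  qed auto
  moreover have "((\<lambda>t. f (x + t *\<^sub>R v)) has_real_derivative inner g v) (at 0)"
    by (rule has_real_derivative_along_line) (use S v D in auto)
  ultimately have "f (x + 1 *\<^sub>R v) - f (x + 0 *\<^sub>R v) \<ge> inner g v * (1 - 0)"
    by (intro convex_on_imp_above_tangent[of UNIV]) auto
  then show ?thesis by (simp add: v_def)
qed

lemma descent_subspace:
  fixes f :: "'a::real_inner \<Rightarrow> real"
  assumes S: "subspace S" "x \<in> S" "y \<in> S"
    and D: "\<And>w. w \<in> S \<Longrightarrow> (f has_derivative (\<lambda>h. inner (g w) h)) (at w within S)"
    and lip: "\<And>w. w \<in> S \<Longrightarrow> norm (g w - g x) \<le> L * norm (w - x)"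
  shows "f y \<le> f x + inner (g x) (y - x) + L / 2 * (norm (y - x))\<^sup>2"
proof -
  define v where "v = y - x"
  have v: "v \<in> S" using S by (simp add: v_def subspace_diff)
  have line: "x + t *\<^sub>R v \<in> S" for t
    using S v by (simp add: subspace_add subspace_scale)
  \<comment> \<open>Along the segment, \<open>\<phi>\<close> is \<open>f\<close> minus the claimed
    bound, up to the constant \<open>f x\<close>; the Lipschitz condition makes its derivative
    nonpositive.\<close>
  define \<phi> where "\<phi> t = f (x + t *\<^sub>R v) - t * inner (g x) v - L / 2 * t\<^sup>2 * (norm v)\<^sup>2" for t
  have "\<phi> 1 \<le> \<phi> 0"
  proof (rule DERIV_nonpos_imp_nonincreasing[of 0 1])
    fix t :: real
    assume t: "0 \<le> t" "t \<le> 1"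
    let ?D = "inner (g (x + t *\<^sub>R v)) v - inner (g x) v - L * t * (norm v)\<^sup>2"
    have *: "((\<lambda>t. f (x + t *\<^sub>R v)) has_real_derivative inner (g (x + t *\<^sub>R v)) v) (at t)"
      by (rule has_real_derivative_along_line) (use S v D line in auto)
    have "(\<phi> has_real_derivative ?D) (at t)"
      unfolding \<phi>_def by (rule derivative_eq_intros * refl | simp)+
    moreover have "inner (g (x + t *\<^sub>R v) - g x) v \<le> L * norm (t *\<^sub>R v) * norm v"
      by (rule order_trans[OF norm_cauchy_schwarz])
        (use lip[OF line, of t] in \<open>auto intro!: mult_right_mono\<close>)
    then have "?D \<le> 0"
      using t by (simp add: inner_diff_left power2_eq_square)
    ultimately show "\<exists>D. (\<phi> has_real_derivative D) (at t) \<and> D \<le> 0" by blast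
  qed simp
  then show ?thesis by (simp add: \<phi>_def v_def)
qed

text \<open>
  The point \<open>x'\<close> divides the segment from \<open>x\<close> to \<open>z'\<close> in the same ratio as \<open>y\<close> divides the
  one from \<open>x\<close> to \<open>z\<close>, so the tangent bounds at \<open>x\<close> and \<open>xs\<close> combine to
  \<open>inner Gy (z' - xs)\<close>, and \<open>z' - z\<close> is a multiple of \<open>g\<close>.
\<close>

lemma nesterov_step:
  fixes x y x' xs g Gy :: "'a::real_inner" and F :: "'a \<Rightarrow> real"
  assumes \<eta>: "\<eta> \<ge> 0" "\<eta> * L \<le> 1" and t: "t \<ge> 0"
    and tangent: "F y + inner Gy (x - y) \<le> F x" "F y + inner Gy (xs - y) \<le> F xs"
    and descent: "F x' \<le> F y + inner Gy (x' - y) + L / 2 * (norm (x' - y))\<^sup>2"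
    and x': "x' = y - \<eta> *\<^sub>R g"
    and z: "z = ((t + 2) / 2) *\<^sub>R y - (t / 2) *\<^sub>R x"
    and z': "z' = ((t + 2) / 2) *\<^sub>R x' - (t / 2) *\<^sub>R x"
  shows "\<eta> * ((t + 2)\<^sup>2 / 4) * (F x' - F xs) + (norm (z' - xs))\<^sup>2 / 2
    \<le> \<eta> * (t * (t + 2) / 4) * (F x - F xs) + (norm (z - xs))\<^sup>2 / 2
      + \<eta> * ((t + 2) / 2) * norm (g - Gy) * norm (z' - xs)"
proof -
  define b where "b = (t + 2) / 2"
  have t_eq: "t = 2 * b - 2" by (simp add: b_def field_simps)
  have b: "b \<ge> 1" using t by (simp add: b_def)
  have z'_eq: "z' = b *\<^sub>R x' - (b - 1) *\<^sub>R x"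
    by (simp add: z' b_def add_divide_distrib)
  define q where "q = (\<eta> * b) *\<^sub>R g"
  have zq: "z - xs = (z' - xs) + q"
    by (simp add: z z' x' q_def b_def algebra_simps)
  \<comment> \<open>Since \<open>b\<^sup>2 = b * (b - 1) + b\<close>, the terms \<open>F y\<close>
    on the right cancel and the inner products collect into the one with
    \<open>z' - xs\<close>.\<close>
  have "b\<^sup>2 * F x' - b * (b - 1) * F x - b * F xs
      \<le> b\<^sup>2 * (F y + inner Gy (x' - y) + L / 2 * (norm (x' - y))\<^sup>2)
        - b * (b - 1) * (F y + inner Gy (x - y)) - b * (F y + inner Gy (xs - y))"
    using b tangent descent by (intro diff_mono mult_left_mono) auto
  also have "\<dots> = b * inner Gy (z' - xs) + L / 2 * (b\<^sup>2 * (norm (x' - y))\<^sup>2)"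
    by (simp add: z'_eq inner_diff_right algebra_simps power2_eq_square)
  finally have "\<eta> * (b\<^sup>2 * F x' - b * (b - 1) * F x - b * F xs)
      \<le> \<eta> * (b * inner Gy (z' - xs) + L / 2 * (b\<^sup>2 * (norm (x' - y))\<^sup>2))"
    using \<eta> by (intro mult_left_mono) auto
  also have "\<dots> = \<eta> * b * inner Gy (z' - xs) + (\<eta> * L) * ((norm q)\<^sup>2 / 2)"
    by (simp add: x' q_def power_mult_distrib algebra_simps)
  also have "(\<eta> * L) * ((norm q)\<^sup>2 / 2) \<le> 1 * ((norm q)\<^sup>2 / 2)"
    using \<eta> by (intro mult_right_mono) auto
  also have "\<eta> * b * inner Gy (z' - xs)
      = inner q (z' - xs) + \<eta> * b * inner (Gy - g) (z' - xs)"
    by (simp add: q_def inner_diff_left algebra_simps)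
  also have "inner (Gy - g) (z' - xs) \<le> norm (g - Gy) * norm (z' - xs)"
    by (metis norm_cauchy_schwarz norm_minus_commute)
  finally have "\<eta> * (b\<^sup>2 * F x' - b * (b - 1) * F x - b * F xs)
      \<le> inner q (z' - xs) + \<eta> * b * (norm (g - Gy) * norm (z' - xs)) + (norm q)\<^sup>2 / 2"
    using \<eta> b by (simp add: mult_left_mono)
  \<comment> \<open>Thus \<open>inner q (z' - xs)\<close> plus half of
    \<open>(norm q)\<^sup>2\<close> is exactly half the decrease of the squared distance to
    \<open>xs\<close>.\<close>
  moreover have "(norm (z - xs))\<^sup>2 = (norm (z' - xs))\<^sup>2 + 2 * inner q (z' - xs) + (norm q)\<^sup>2"
    unfolding zq by (simp add: power2_norm_eq_inner inner_add_left inner_add_right inner_commute)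
  moreover have eqs: "(t + 2)\<^sup>2 / 4 = b\<^sup>2" "t * (t + 2) / 4 = b * (b - 1)"
    by (simp_all add: t_eq field_simps power2_eq_square)
  ultimately show ?thesis
    unfolding eqs b_def[symmetric] by (simp add: algebra_simps power2_eq_square)
qed

text \<open>The noise contains \<open>d\<close>, which only \<open>E\<close> itself controls, so the
  hypothesis is implicit in \<open>E\<close>. Young's inequality splits the noise into parts of
  \<open>B\<close> and \<open>E\<close>; the latter moves to the left, and dividing by
  \<open>1 - 1 / T\<close>, at least 1/2, costs only a larger multiple of
  \<open>1 / T\<close>.\<close>

lemma perturbed_growth:
  fixes E B s r d T :: real
  assumes T: "T \<ge> 2" and E: "E \<le> (1 + 1 / T) * B + 1 / (2 * T) * ((s + r) * d)"
    and s: "s\<^sup>2 \<le> B" and r: "r\<^sup>2 / 2 \<le> B" and d: "d\<^sup>2 / 2 \<le> E"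
  shows "E \<le> (1 + 6 / T) * B"
proof -
  define u where "u = 1 / T"
  have u: "0 < u" "u \<le> 1 / 2" using T by (auto simp: u_def field_simps)
  have B: "B \<ge> 0" using s zero_le_power2[of s] by linarith
  have "(s + r) * d \<le> s\<^sup>2 / 2 + r\<^sup>2 / 2 + d\<^sup>2"
    using sum_squares_bound[of s d] sum_squares_bound[of r d] by (simp add: algebra_simps)
  also have "\<dots> \<le> 3 / 2 * B + 2 * E" using s r d by simp
  finally have "u / 2 * ((s + r) * d) \<le> u / 2 * (3 / 2 * B + 2 * E)"
    using u by (intro mult_left_mono) auto
  then have "(1 - u) * E \<le> (1 + 7 / 4 * u) * B"
    using E by (simp add: u_def algebra_simps)
  also have "\<dots> \<le> ((1 - u) * (1 + 6 * u)) * B"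
  proof (rule mult_right_mono)
    have "u * u \<le> 1 / 2 * u" using u by (intro mult_right_mono) auto
    moreover have "(1 - u) * (1 + 6 * u) = 1 + 5 * u - 6 * (u * u)"
      by (simp add: algebra_simps)
    ultimately show "1 + 7 / 4 * u \<le> (1 - u) * (1 + 6 * u)"
      using u by linarith
  qed (rule B)
  finally have "(1 - u) * E \<le> (1 - u) * ((1 + 6 * u) * B)" by (simp add: mult.assoc)
  then have "E \<le> (1 + 6 * u) * B"
    by (rule mult_left_le_imp_le) (use u in simp)
  then show ?thesis by (simp add: u_def)
qed

section \<open>Size of the learning rates\<close>

lemma epoch_rate_pos: "L > 0 \<Longrightarrow> T \<ge> 1 \<Longrightarrow> epoch_rate L T t > 0"
  unfolding epoch_rate_def Let_def
  by (intro divide_pos_pos mult_pos_pos zero_less_power) (auto intro: add_pos_nonneg)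

lemma epoch_rate_Suc: "epoch_rate L T (Suc t) = (1 + 1 / real T) * epoch_rate L T t"
  by (simp add: epoch_rate_def Let_def)

text \<open>The factor \<open>1 / T\<close> is what keeps the noise of one epoch summable over
  \<open>T\<close> epochs. The power \<open>\<alpha> ^ t\<close> is at most \<open>exp 1\<close>,
  which \<open>k\<close> divides out, and the 2 comes from 8 \<le> 12.\<close>

lemma epoch_rate_le_half:
  assumes "L > 0" "T \<ge> 1" "t \<le> T"
  shows "epoch_rate L T t * L \<le> 1 / (2 * real T)"
proof -
  define \<alpha> where "\<alpha> = 1 + 1 / real T"
  have \<alpha>: "\<alpha> \<ge> 1" by (simp add: \<alpha>_def)
  have r: "2 \<le> root 3 (12::real)"
    using real_root_le_mono[of 3 8 12] real_root_power_cancel[of 3 2] by simp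
  have "\<alpha> ^ t \<le> \<alpha> ^ T" using \<alpha> assms by (simp add: power_increasing)
  also have "\<dots> \<le> exp (1 / real T) ^ T"
    unfolding \<alpha>_def by (intro power_mono exp_ge_add_one_self) auto
  also have "\<dots> = exp 1"
    using assms by (simp add: exp_of_nat_mult[symmetric])
  finally have "\<alpha> ^ t * 2 \<le> exp 1 * 1 * 2" by simp
  also have "\<dots> \<le> exp 1 * \<alpha> * root 3 12"
    using \<alpha> r by (intro mult_mono) auto
  finally have "\<alpha> ^ t * 2 \<le> exp 1 * \<alpha> * root 3 12" .
  moreover have "0 < exp 1 * \<alpha> * root 3 12"
    using \<alpha> r by (intro mult_pos_pos) auto
  ultimately have "1 / (exp 1 * \<alpha> * root 3 12) * \<alpha> ^ t \<le> 1 / 2"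
    by (simp add: field_simps)
  then have "1 / (exp 1 * \<alpha> * root 3 12) * \<alpha> ^ t / real T \<le> (1 / 2) / real T"
    by (intro divide_right_mono) auto
  then show ?thesis
    using assms by (simp add: epoch_rate_def Let_def \<alpha>_def)
qed

text \<open>One factor of \<open>\<alpha> ^ T\<close> cancels the \<open>\<alpha>\<close> in
  \<open>k\<close>; then \<open>exp 1\<close> \<le> 3 and 12 \<le> 27 give the 9.\<close>

lemma epoch_rate_last_ge:
  assumes "L > 0" "T \<ge> 1"
  shows "epoch_rate L T T * L \<ge> 1 / (9 * real T)"
proof -
  define \<alpha> where "\<alpha> = 1 + 1 / real T"
  have \<alpha>: "\<alpha> \<ge> 1" by (simp add: \<alpha>_def)
  have r: "root 3 (12::real) \<le> 3"
    using real_root_le_mono[of 3 12 27] real_root_power_cancel[of 3 3] by simp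
  have "exp 1 * \<alpha> * root 3 12 \<le> 3 * \<alpha> * 3"
    using \<alpha> r exp_le by (intro mult_mono) auto
  also have "\<dots> \<le> 9 * \<alpha> ^ T"
    using \<alpha> assms power_increasing[of 1 T \<alpha>] by simp
  finally have "1 / 9 \<le> 1 / (exp 1 * \<alpha> * root 3 12) * \<alpha> ^ T"
    using \<alpha> by (simp add: field_simps)
  then have "1 / 9 / real T \<le> 1 / (exp 1 * \<alpha> * root 3 12) * \<alpha> ^ T / real T"
    by (intro divide_right_mono) auto
  then show ?thesis
    using assms by (simp add: epoch_rate_def Let_def \<alpha>_def)
qed

text \<open>This is Cauchy-Schwarz: an epoch produces a mean of norms, while \<sigma> is a quadratic
  mean. For \<open>n = 0\<close> both sides are 0 because division by zero gives 0.\<close>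

lemma mean_le_sqrt_mean_square:
  fixes a :: "nat \<Rightarrow> real"
  shows "(\<Sum>i=1..n. a i) / real n \<le> sqrt ((\<Sum>i=1..n. (a i)\<^sup>2) / real n)"
proof (cases "n = 0")
  case False
  have "(\<Sum>i=1..n. a i)\<^sup>2 \<le> real n * (\<Sum>i=1..n. (a i)\<^sup>2)"
    using sum_squared_le_sum_of_squares[of a "{1..n}"] by (simp add: mult.commute)
  then have "((\<Sum>i=1..n. a i) / real n)\<^sup>2 \<le> (\<Sum>i=1..n. (a i)\<^sup>2) / real n"
    using False by (simp add: power_divide field_simps power2_eq_square)
  then show ?thesis by (rule real_le_rsqrt)
qed simp

section \<open>One epoch as a perturbed gradient step\<close>

text \<open>Gradients are given as data on a subspace; the theorem supplies \<open>rn d\<close> and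
  \<open>grad_on\<close>. The assumption \<open>grad_in\<close> keeps all iterates in
  \<open>S\<close>, where the other assumptions apply.\<close>

locale convex_smooth_sum =
  fixes S :: "'a::real_inner set" and f :: "nat \<Rightarrow> 'a \<Rightarrow> real" and G :: "nat \<Rightarrow> 'a \<Rightarrow> 'a"
    and L :: real and n :: nat
  assumes S: "subspace S" and L: "L > 0" and n: "n \<ge> 1"
    and convex: "i \<in> {1..n} \<Longrightarrow> convex_on S (f i)"
    and grad: "i \<in> {1..n} \<Longrightarrow> w \<in> S \<Longrightarrow> (f i has_derivative (\<lambda>h. inner (G i w) h)) (at w within S)"
    and grad_in: "i \<in> {1..n} \<Longrightarrow> w \<in> S \<Longrightarrow> G i w \<in> S"
    and lipschitz: "i \<in> {1..n} \<Longrightarrow> v \<in> S \<Longrightarrow> w \<in> S \<Longrightarrow> norm (G i v - G i w) \<le> L * norm (v - w)"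
begin

definition grad_avg :: "'a \<Rightarrow> 'a" where
  "grad_avg w = (1 / real n) *\<^sub>R (\<Sum>i=1..n. G i w)"

lemma avg_above_tangent:
  assumes "x \<in> S" "y \<in> S"
  shows "avg n f x + inner (grad_avg x) (y - x) \<le> avg n f y"
proof -
  have "(\<Sum>i=1..n. f i x + inner (G i x) (y - x)) \<le> (\<Sum>i=1..n. f i y)"
    (is "?l \<le> ?r")
    by (intro sum_mono convex_on_above_tangent_subspace[OF S] convex grad assms) auto
  then have "?l / real n \<le> ?r / real n" by (rule divide_right_mono) simp
  then show ?thesis
    using n by (simp add: avg_def grad_avg_def sum.distrib inner_sum_left add_divide_distrib)
qed

lemma avg_descent:
  assumes "x \<in> S" "y \<in> S"
  shows "avg n f y \<le> avg n f x + inner (grad_avg x) (y - x) + L / 2 * (norm (y - x))\<^sup>2"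
proof -
  have "(\<Sum>i=1..n. f i y)
      \<le> (\<Sum>i=1..n. f i x + inner (G i x) (y - x) + L / 2 * (norm (y - x))\<^sup>2)"
    (is "?l \<le> ?r")
    by (intro sum_mono descent_subspace[OF S] grad lipschitz assms) auto
  then have "?l / real n \<le> ?r / real n" by (rule divide_right_mono) simp
  then show ?thesis
    using n by (simp add: avg_def grad_avg_def sum.distrib inner_sum_left add_divide_distrib)
qed

context
  fixes p :: "nat \<Rightarrow> nat" and y :: 'a
  assumes p: "p permutes {1..n}" and y: "y \<in> S"
begin

lemma p_in: "i < n \<Longrightarrow> p (Suc i) \<in> {1..n}"
  using permutes_in_image[OF p, of "Suc i"] by simp

lemma nasg_epoch_in: "i \<le> n \<Longrightarrow> nasg_epoch G p h y i \<in> S"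
proof (induction i)
  case (Suc i)
  then show ?case
    using p_in[of i] by (simp add: subspace_diff[OF S] subspace_scale[OF S] grad_in)
qed (simp add: y)

lemma nasg_epoch_eq_sum:
  "nasg_epoch G p (\<lambda>_. h) y i = y - h *\<^sub>R (\<Sum>j<i. G (p (Suc j)) (nasg_epoch G p (\<lambda>_. h) y j))"
  by (induction i) (simp_all add: algebra_simps)

text \<open>A Gronwall estimate inside the epoch: the gradient used differs from that of the same
  component at \<open>y\<close> by at most \<open>L\<close> times the current drift, so each step
  multiplies the drift by at most \<open>1 + h * L\<close> and adds one gradient norm at
  \<open>y\<close>.\<close>

lemma nasg_epoch_drift:
  assumes h: "h \<ge> 0"
  shows "i \<le> n \<Longrightarrow> norm (nasg_epoch G p (\<lambda>_. h) y i - y)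
    \<le> h * (1 + h * L) ^ i * (\<Sum>j<i. norm (G (p (Suc j)) y))"
proof (induction i)
  case (Suc i)
  let ?w = "nasg_epoch G p (\<lambda>_. h) y i"
  let ?g = "\<lambda>j. norm (G (p (Suc j)) y)"
  have q: "(1 + h * L) ^ Suc i \<ge> 1" using h L by (intro one_le_power) simp
  have "norm (G (p (Suc i)) ?w) \<le> norm (G (p (Suc i)) ?w - G (p (Suc i)) y) + ?g i"
    using norm_triangle_ineq[of "G (p (Suc i)) ?w - G (p (Suc i)) y" "G (p (Suc i)) y"] by simp
  also have "\<dots> \<le> L * norm (?w - y) + ?g i"
    using lipschitz[OF p_in[of i] nasg_epoch_in[of i "\<lambda>_. h"] y] Suc.prems by simp
  finally have Gw: "norm (G (p (Suc i)) ?w) \<le> L * norm (?w - y) + ?g i" .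
  have "norm (nasg_epoch G p (\<lambda>_. h) y (Suc i) - y) \<le> norm (?w - y) + h * norm (G (p (Suc i)) ?w)"
    using norm_triangle_ineq4[of "?w - y" "h *\<^sub>R G (p (Suc i)) ?w"] h by (simp add: algebra_simps)
  also have "\<dots> \<le> norm (?w - y) + h * (L * norm (?w - y) + ?g i)"
    using Gw h by (simp add: mult_left_mono)
  also have "\<dots> = (1 + h * L) * norm (?w - y) + h * 1 * ?g i"
    by (simp add: algebra_simps)
  also have "\<dots> \<le> (1 + h * L) * (h * (1 + h * L) ^ i * (\<Sum>j<i. ?g j)) + h * (1 + h * L) ^ Suc i * ?g i"
    using Suc h L q by (intro add_mono mult_left_mono mult_right_mono) auto
  also have "\<dots> = h * (1 + h * L) ^ Suc i * (\<Sum>j<Suc i. ?g j)"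
    by (simp add: algebra_simps)
  finally show ?case .
qed simp

lemma sum_permuted:
  fixes \<phi> :: "nat \<Rightarrow> 'b::comm_monoid_add"
  shows "(\<Sum>j<n. \<phi> (p (Suc j))) = (\<Sum>i=1..n. \<phi> i)"
proof -
  have "(\<Sum>j<n. \<phi> (p (Suc j))) = (\<Sum>i=1..n. \<phi> (p i))"
    by (simp add: sum.atLeast1_atMost_eq lessThan_atLeast0)
  also have "\<dots> = (\<Sum>i=1..n. \<phi> i)"
    by (rule sum.permute[OF p, symmetric, unfolded comp_def])
  finally show ?thesis .
qed

text \<open>Here \<sigma> enters: the Lipschitz condition moves the gradients from \<open>y\<close>
  to \<open>xs\<close>.\<close>

lemma mean_norm_grad_le:
  assumes xs: "xs \<in> S"
  shows "(\<Sum>i=1..n. norm (G i y)) / real n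
    \<le> sqrt ((\<Sum>i=1..n. (norm (G i xs))\<^sup>2) / real n) + L * norm (y - xs)"
proof -
  have "(\<Sum>i=1..n. norm (G i y)) \<le> (\<Sum>i=1..n. norm (G i xs) + L * norm (y - xs))"
  proof (rule sum_mono)
    fix i assume "i \<in> {1..n}"
    then show "norm (G i y) \<le> norm (G i xs) + L * norm (y - xs)"
      using lipschitz[of i y xs] norm_triangle_ineq[of "G i y - G i xs" "G i xs"] y xs by simp
  qed
  then have "(\<Sum>i=1..n. norm (G i y)) / real n
      \<le> (\<Sum>i=1..n. norm (G i xs)) / real n + L * norm (y - xs)"
    using n by (simp add: sum.distrib field_simps)
  then show ?thesis
    using mean_le_sqrt_mean_square[of "\<lambda>i. norm (G i xs)" n] by linarith
qed

text \<open>The epoch moves along the mean of the gradients at the inner iterates. Each component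
  occurs once, so the same mean taken at \<open>y\<close> is exactly \<open>grad_avg y\<close>; the
  error is at most \<open>L\<close> times the drift.\<close>

lemma nasg_epoch_gradient_error:
  assumes \<eta>: "\<eta> \<ge> 0" "\<eta> * L \<le> 1 / 4" and xs: "xs \<in> S"
  obtains g where "nasg_epoch G p (\<lambda>_. \<eta> / real n) y n = y - \<eta> *\<^sub>R g"
    and "norm (g - grad_avg y) \<le> 4 / 3 * (\<eta> * L) *
      (sqrt ((\<Sum>i=1..n. (norm (G i xs))\<^sup>2) / real n) + L * norm (y - xs))"
proof
  define h where "h = \<eta> / real n"
  have h: "h \<ge> 0" using \<eta> by (simp add: h_def)
  define w where "w = nasg_epoch G p (\<lambda>_. h) y"
  define Q where "Q = (\<Sum>i=1..n. norm (G i y))"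
  define g where "g = (1 / real n) *\<^sub>R (\<Sum>j<n. G (p (Suc j)) (w j))"
  show "nasg_epoch G p (\<lambda>_. \<eta> / real n) y n = y - \<eta> *\<^sub>R g"
    using nasg_epoch_eq_sum[of h n] by (simp add: g_def w_def h_def)
  \<comment> \<open>The constant 4/3 bounds 1 + 1/4 + 1/16, an upper bound for
    \<open>exp (\<eta> * L)\<close>.\<close>
  have "(1 + h * L) ^ n \<le> exp (h * L) ^ n"
    using h L by (intro power_mono exp_ge_add_one_self) auto
  also have "\<dots> = exp (\<eta> * L)"
    using n by (simp add: exp_of_nat_mult[symmetric] h_def)
  also have "\<dots> \<le> 1 + \<eta> * L + (\<eta> * L)\<^sup>2"
    using \<eta> L by (intro exp_bound) auto
  also have "\<dots> \<le> 1 + 1 / 4 + (1 / 4)\<^sup>2"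
    using \<eta> L by (intro add_mono power_mono) auto
  also have "\<dots> \<le> 4 / 3"
    by (simp add: power2_eq_square)
  finally have pow: "(1 + h * L) ^ n \<le> 4 / 3" .
  have drift: "norm (w j - y) \<le> h * (4 / 3) * Q" if "j < n" for j
  proof -
    have "(1 + h * L) ^ j \<le> (1 + h * L) ^ n"
      using that h L by (intro power_increasing) auto
    moreover have "(\<Sum>i<j. norm (G (p (Suc i)) y)) \<le> (\<Sum>i<n. norm (G (p (Suc i)) y))"
      using that by (intro sum_mono2) auto
    ultimately have "h * (1 + h * L) ^ j * (\<Sum>i<j. norm (G (p (Suc i)) y)) \<le> h * (4 / 3) * Q"
      using pow h L sum_permuted[of "\<lambda>i. norm (G i y)"]
      by (intro mult_mono) (auto simp: Q_def intro: sum_nonneg)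
    then show ?thesis
      using nasg_epoch_drift[OF h, of j] that unfolding w_def by linarith
  qed
  have "norm (\<Sum>j<n. G (p (Suc j)) (w j) - G (p (Suc j)) y) \<le> (\<Sum>j<n. L * (h * (4 / 3) * Q))"
  proof (rule sum_norm_le)
    fix j assume "j \<in> {..<n}"
    then have j: "j < n" by simp
    have "norm (G (p (Suc j)) (w j) - G (p (Suc j)) y) \<le> L * norm (w j - y)"
      using lipschitz[OF p_in[OF j] _ y] nasg_epoch_in[of j] j by (simp add: w_def)
    also have "\<dots> \<le> L * (h * (4 / 3) * Q)"
      using drift[OF j] L by (intro mult_left_mono) auto
    finally show "norm (G (p (Suc j)) (w j) - G (p (Suc j)) y) \<le> L * (h * (4 / 3) * Q)" .
  qed
  moreover have "g - grad_avg y
      = (1 / real n) *\<^sub>R (\<Sum>j<n. G (p (Suc j)) (w j) - G (p (Suc j)) y)"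
    using sum_permuted[of "\<lambda>i. G i y"]
    by (simp add: g_def grad_avg_def sum_subtractf scaleR_diff_right)
  ultimately have "norm (g - grad_avg y) \<le> (1 / real n) * (real n * (L * (h * (4 / 3) * Q)))"
    using n by (simp add: field_simps)
  also have "\<dots> = 4 / 3 * (\<eta> * L) * (Q / real n)"
    using n by (simp add: h_def field_simps)
  also have "\<dots> \<le> 4 / 3 * (\<eta> * L) *
      (sqrt ((\<Sum>i=1..n. (norm (G i xs))\<^sup>2) / real n) + L * norm (y - xs))"
    using mean_norm_grad_le[OF xs] \<eta> L unfolding Q_def by (intro mult_left_mono) auto
  finally show "norm (g - grad_avg y) \<le> 4 / 3 * (\<eta> * L) *
      (sqrt ((\<Sum>i=1..n. (norm (G i xs))\<^sup>2) / real n) + L * norm (y - xs))" .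
qed

end

section \<open>Gronwall induction over the epochs\<close>

lemma nasg_bound:
  fixes T :: nat and \<pi> :: "nat \<Rightarrow> nat \<Rightarrow> nat" and x0 xs :: 'a
  defines "N \<equiv> nasg n G \<pi> momentum (\<lambda>t i. epoch_rate L T t / real n) x0 x0"
  assumes T: "T \<ge> 2" and \<pi>: "\<And>t. t \<in> {1..T} \<Longrightarrow> \<pi> t permutes {1..n}"
    and xs: "xs \<in> S" and x0: "x0 \<in> S" and min: "\<And>w. w \<in> S \<Longrightarrow> avg n f xs \<le> avg n f w"
  shows "avg n f (fst (N T)) - avg n f xs
    \<le> 36 * exp 6 * ((\<Sum>i=1..n. (norm (G i xs))\<^sup>2) / real n / L + L * (norm (x0 - xs))\<^sup>2) / real T"
proof -
  define \<sigma> where "\<sigma> = sqrt ((\<Sum>i=1..n. (norm (G i xs))\<^sup>2) / real n)"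
  have \<sigma>2: "\<sigma>\<^sup>2 = (\<Sum>i=1..n. (norm (G i xs))\<^sup>2) / real n"
    by (simp add: \<sigma>_def sum_nonneg)
  define s where "s = \<sigma> / L"
  have s_nonneg: "s \<ge> 0"
    using L by (simp add: s_def \<sigma>_def sum_nonneg)
  define \<eta> where "\<eta> = epoch_rate L T"
  define x where "x t = fst (N t)" for t
  define y where "y t = snd (N t)" for t
  define z where "z t = ((real t + 2) / 2) *\<^sub>R y t - (real t / 2) *\<^sub>R x t" for t
  define \<delta> where "\<delta> t = avg n f (x t) - avg n f xs" for t
  define E where "E t = \<eta> t * (real t * (real t + 2) / 4) * \<delta> t + (norm (z t - xs))\<^sup>2 / 2" for t
  \<comment> \<open>Including \<open>s\<^sup>2\<close> in the initial value lets \<open>B t\<close>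
    absorb the part of the noise that comes from \<sigma>.\<close>
  define B where "B t = (1 + 6 / real T) ^ t * ((norm (x0 - xs))\<^sup>2 / 2 + s\<^sup>2)" for t
  have \<eta>_pos: "\<eta> t > 0" for t using epoch_rate_pos L T by (simp add: \<eta>_def)
  have \<eta>_Suc: "\<eta> (Suc t) = (1 + 1 / real T) * \<eta> t" for t
    by (simp add: \<eta>_def epoch_rate_Suc)
  have \<eta>_le: "\<eta> t * L \<le> 1 / (2 * real T)" if "t \<le> T" for t
    using epoch_rate_le_half[OF L _ that] T by (simp add: \<eta>_def)
  have x_Suc: "x (Suc t) = nasg_epoch G (\<pi> (Suc t)) (\<lambda>_. \<eta> (Suc t) / real n) (y t) n" for t
    by (simp add: x_def y_def N_def \<eta>_def Let_def case_prod_beta)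
  have y_Suc: "y (Suc t) = x (Suc t) + (real t / (real t + 3)) *\<^sub>R (x (Suc t) - x t)" for t
    by (simp add: x_def y_def N_def Let_def case_prod_beta momentum_def add.commute)
  have init: "x 0 = x0" "y 0 = x0" by (simp_all add: x_def y_def N_def)
  have in_S: "t \<le> T \<Longrightarrow> x t \<in> S \<and> y t \<in> S" for t
  proof (induction t)
    case (Suc t)
    then have "x (Suc t) \<in> S"
      unfolding x_Suc by (intro nasg_epoch_in \<pi>) auto
    with Suc show ?case
      by (simp add: y_Suc subspace_add[OF S] subspace_diff[OF S] subspace_scale[OF S])
  qed (simp add: init x0)
  \<comment> \<open>Here \<open>momentum (Suc t)\<close> is t/(t+3), exactly the value that gives
    \<open>z (Suc t)\<close> the weights of \<open>z t\<close>, as \<open>nesterov_step\<close>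
    requires of its \<open>z'\<close>.\<close>
  have z_Suc: "z (Suc t) = ((real t + 2) / 2) *\<^sub>R x (Suc t) - (real t / 2) *\<^sub>R x t" for t
  proof -
    have "z (Suc t) = ((real t + 3) / 2 + (real t + 3) / 2 * (real t / (real t + 3)) - (real t + 1) / 2) *\<^sub>R x (Suc t)
      - ((real t + 3) / 2 * (real t / (real t + 3))) *\<^sub>R x t"
      unfolding z_def y_Suc by (simp add: algebra_simps)
    also have "(real t + 3) / 2 * (real t / (real t + 3)) = real t / 2"
      by (simp add: field_simps)
    also have "(real t + 3) / 2 + real t / 2 - (real t + 1) / 2 = (real t + 2) / 2"
      by (simp add: field_simps)
    finally show ?thesis .
  qed
  have \<delta>_nonneg: "\<delta> t \<ge> 0" if "t \<le> T" for t
    using min in_S[OF that] by (simp add: \<delta>_def)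
  have B_Suc: "B (Suc t) = (1 + 6 / real T) * B t" for t by (simp add: B_def)
  have mono: "B t \<le> B (Suc t)" for t
    unfolding B_def by (intro mult_right_mono power_increasing) auto
  have s_B: "s\<^sup>2 \<le> B t" for t
  proof -
    have "1 * s\<^sup>2 \<le> B t" unfolding B_def
      by (intro mult_mono one_le_power) auto
    then show ?thesis by simp
  qed
  have B_nonneg: "B t \<ge> 0" for t
    using s_B[of t] zero_le_power2[of s] by linarith
  \<comment> \<open>Balls are convex, so distance bounds pass from \<open>x t\<close> and
    \<open>z\<close> to \<open>y t\<close> and \<open>x (Suc t)\<close>.\<close>
  have ball: "norm (((real t / (real t + 2)) *\<^sub>R u + (2 / (real t + 2)) *\<^sub>R v) - xs) \<le> b"
    if "norm (u - xs) \<le> b" "norm (v - xs) \<le> b" for t u v b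
  proof -
    have "(real t / (real t + 2)) *\<^sub>R u + (2 / (real t + 2)) *\<^sub>R v \<in> cball xs b"
      by (rule convexD[OF convex_cball])
        (use that in \<open>auto simp: dist_norm norm_minus_commute add_divide_distrib[symmetric]\<close>)
    then show ?thesis by (simp add: dist_norm norm_minus_commute)
  qed
  have split: "v = (real t / (real t + 2)) *\<^sub>R u
      + (2 / (real t + 2)) *\<^sub>R (((real t + 2) / 2) *\<^sub>R v - (real t / 2) *\<^sub>R u)" for t and u v :: 'a
  proof -
    have *: "a *\<^sub>R u + b *\<^sub>R (c *\<^sub>R v - e *\<^sub>R u) = (b * c) *\<^sub>R v + (a - b * e) *\<^sub>R u"
      for a b c e :: real by (simp add: algebra_simps)
    have "real t + 2 \<noteq> 0" by linarith
    then have "2 / (real t + 2) * ((real t + 2) / 2) = 1"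
      and "real t / (real t + 2) - 2 / (real t + 2) * (real t / 2) = 0"
      by (simp_all add: field_simps)
    then show ?thesis unfolding * by (simp only: scaleR_one scaleR_zero_left add_0_right)
  qed
  have y_eq: "y t = (real t / (real t + 2)) *\<^sub>R x t + (2 / (real t + 2)) *\<^sub>R z t" for t
    unfolding z_def by (rule split)
  have x_Suc_eq: "x (Suc t) = (real t / (real t + 2)) *\<^sub>R x t + (2 / (real t + 2)) *\<^sub>R z (Suc t)" for t
    unfolding z_Suc by (rule split)
  \<comment> \<open>Function values do not bound distances under mere convexity, so the distance of
    \<open>x t\<close> is carried along; it bounds that of \<open>y t\<close>, which enters the
    noise.\<close>
  have "E t \<le> B t \<and> norm (x t - xs) \<le> sqrt (2 * B t)" if "t \<le> T" for t
    using that
  proof (induction t)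
    case 0
    \<comment> \<open>At 0 the weight of \<open>\<delta>\<close> vanishes, so \<open>E 0\<close> is
      half the squared initial distance.\<close>
    show ?case
      by (auto simp: E_def B_def init z_def intro!: real_le_rsqrt)
  next
    case (Suc t)
    then have t: "t \<le> T" "t < T" by auto
    have in_t: "x t \<in> S" "y t \<in> S" "x (Suc t) \<in> S" using in_S t Suc.prems by auto
    have \<eta>L: "\<eta> (Suc t) * L \<le> 1 / 4"
    proof -
      have "1 / (2 * real T) \<le> 1 / 4" using T by (simp add: field_simps)
      then show ?thesis using \<eta>_le[OF Suc.prems] by linarith
    qed
    obtain g where g: "x (Suc t) = y t - \<eta> (Suc t) *\<^sub>R g"
      and err: "norm (g - grad_avg (y t)) \<le> 4 / 3 * (\<eta> (Suc t) * L) * (\<sigma> + L * norm (y t - xs))"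
      unfolding x_Suc \<sigma>_def
    proof (rule nasg_epoch_gradient_error[OF _ in_t(2) less_imp_le[OF \<eta>_pos] \<eta>L xs])
      show "\<pi> (Suc t) permutes {1..n}" using \<pi> Suc.prems by simp
    qed
    let ?d = "norm (z (Suc t) - xs)"
    have noise: "\<eta> (Suc t) * ((real t + 2) / 2) * norm (g - grad_avg (y t)) * ?d
        \<le> 1 / (2 * real T) * ((s + norm (y t - xs)) * ?d)"
    proof -
      have "\<eta> (Suc t) * ((real t + 2) / 2) * norm (g - grad_avg (y t))
          \<le> \<eta> (Suc t) * ((real t + 2) / 2) * (4 / 3 * (\<eta> (Suc t) * L) * (\<sigma> + L * norm (y t - xs)))"
        using err \<eta>_pos[of "Suc t"] by (intro mult_left_mono) auto
      also have "\<dots> = 2 / 3 * (real t + 2) * (\<eta> (Suc t) * L)\<^sup>2 * (s + norm (y t - xs))"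
        using L by (simp add: s_def field_simps power2_eq_square)
      also have "\<dots> \<le> 1 / (2 * real T) * (s + norm (y t - xs))"
      proof (rule mult_right_mono)
        \<comment> \<open>The weight grows linearly in \<open>t\<close>, but the noise is quadratic
          in \<open>\<eta> * L\<close>, so a factor \<open>1 / T\<close> survives.\<close>
        have "2 / 3 * (real t + 2) * (\<eta> (Suc t) * L)\<^sup>2 \<le> 2 * real T * (1 / (2 * real T))\<^sup>2"
        proof (rule mult_mono)
          show "2 / 3 * (real t + 2) \<le> 2 * real T" using t T by simp
          show "(\<eta> (Suc t) * L)\<^sup>2 \<le> (1 / (2 * real T))\<^sup>2"
            using \<eta>_le[OF Suc.prems] \<eta>_pos[of "Suc t"] L by (intro power_mono) auto
        qed auto
        also have "\<dots> = 1 / (2 * real T)"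
          using T by (simp add: power2_eq_square)
        finally show "2 / 3 * (real t + 2) * (\<eta> (Suc t) * L)\<^sup>2 \<le> 1 / (2 * real T)" .
      qed (simp add: s_nonneg)
      finally show ?thesis
        unfolding mult.assoc[symmetric] by (rule mult_right_mono) simp
    qed
    have "\<eta> (Suc t) * ((real t + 2)\<^sup>2 / 4) * \<delta> (Suc t) + ?d\<^sup>2 / 2
      \<le> \<eta> (Suc t) * (real t * (real t + 2) / 4) * \<delta> t + (norm (z t - xs))\<^sup>2 / 2
      + \<eta> (Suc t) * ((real t + 2) / 2) * norm (g - grad_avg (y t)) * ?d"
      unfolding \<delta>_def
      using \<eta>L by (intro nesterov_step[OF less_imp_le[OF \<eta>_pos] _ of_nat_0_le_iff
          avg_above_tangent[OF in_t(2,1)] avg_above_tangent[OF in_t(2) xs]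
          avg_descent[OF in_t(2,3)] g z_def z_Suc]) simp
    also have "\<eta> (Suc t) * (real t * (real t + 2) / 4) * \<delta> t + (norm (z t - xs))\<^sup>2 / 2
        \<le> (1 + 1 / real T) * E t"
      by (simp add: \<eta>_Suc E_def algebra_simps)
    also have "\<dots> \<le> (1 + 1 / real T) * B t"
      using Suc by (intro mult_left_mono) auto
    also note noise
    finally have step: "\<eta> (Suc t) * ((real t + 2)\<^sup>2 / 4) * \<delta> (Suc t) + ?d\<^sup>2 / 2
      \<le> (1 + 1 / real T) * B t + 1 / (2 * real T) * ((s + norm (y t - xs)) * ?d)"
      by simp
    \<comment> \<open>The step yields the weight (t+2)^2/4, slightly more than the (t+1)(t+3)/4 in
      \<open>E (Suc t)\<close>; the surplus is dropped as \<open>\<delta>\<close> is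
      nonnegative.\<close>
    have "real (Suc t) * (real (Suc t) + 2) / 4 \<le> (real t + 2)\<^sup>2 / 4"
      by (simp add: power2_eq_square algebra_simps)
    then have "\<eta> (Suc t) * (real (Suc t) * (real (Suc t) + 2) / 4) * \<delta> (Suc t)
        \<le> \<eta> (Suc t) * ((real t + 2)\<^sup>2 / 4) * \<delta> (Suc t)"
      using \<eta>_pos[of "Suc t"] \<delta>_nonneg[OF Suc.prems] by (intro mult_right_mono mult_left_mono) auto
    then have E_le: "E (Suc t) \<le> (1 + 1 / real T) * B t
        + 1 / (2 * real T) * ((s + norm (y t - xs)) * ?d)"
      using step unfolding E_def by linarith
    have d_E: "(norm (z t - xs))\<^sup>2 / 2 \<le> E t" if "t \<le> T" for t
      using \<eta>_pos[of t] \<delta>_nonneg[OF that] by (simp add: E_def)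
    have x_B: "norm (x t - xs) \<le> sqrt (2 * B t)" using Suc by simp
    have z_B: "norm (z t - xs) \<le> sqrt (2 * B t)"
      using d_E[OF t(1)] Suc by (intro real_le_rsqrt) auto
    have "norm (y t - xs) \<le> sqrt (2 * B t)"
      unfolding y_eq by (rule ball[OF x_B z_B])
    then have "(norm (y t - xs))\<^sup>2 / 2 \<le> B t"
      using power_mono[of "norm (y t - xs)" "sqrt (2 * B t)" 2] B_nonneg[of t] by simp
    then have EB: "E (Suc t) \<le> B (Suc t)"
      unfolding B_Suc
      by (intro perturbed_growth[OF _ E_le s_B _ d_E[OF Suc.prems]]) (use T in auto)
    have "norm (x (Suc t) - xs) \<le> sqrt (2 * B (Suc t))"
      unfolding x_Suc_eq
    proof (rule ball)
      show "norm (x t - xs) \<le> sqrt (2 * B (Suc t))"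
        using x_B real_sqrt_le_mono[of "2 * B t" "2 * B (Suc t)"] mono[of t] by linarith
      show "norm (z (Suc t) - xs) \<le> sqrt (2 * B (Suc t))"
        using d_E[OF Suc.prems] EB by (intro real_le_rsqrt) auto
    qed
    with EB show ?case by blast
  qed
  then have "E T \<le> B T" by blast
  then have "\<eta> T * (real T * (real T + 2) / 4) * \<delta> T \<le> B T"
    using zero_le_power2[of "norm (z T - xs)"] unfolding E_def by linarith
  moreover have "B T \<le> exp 6 * ((norm (x0 - xs))\<^sup>2 + s\<^sup>2)"
    unfolding B_def
  proof (rule mult_mono)
    have "(1 + 6 / real T) ^ T \<le> exp (6 / real T) ^ T"
      by (intro power_mono exp_ge_add_one_self) auto
    then show "(1 + 6 / real T) ^ T \<le> exp 6"
      using T by (simp add: exp_of_nat_mult[symmetric])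
  qed auto
  \<comment> \<open>The 36 is the 9 of the rate bound times the 4 of the potential.\<close>
  moreover have "real T / (36 * L) * \<delta> T \<le> \<eta> T * (real T * (real T + 2) / 4) * \<delta> T"
  proof (rule mult_right_mono)
    have "1 / (9 * real T) / L \<le> \<eta> T"
      using epoch_rate_last_ge[of L T] L T by (simp add: \<eta>_def field_simps)
    then have "1 / (9 * real T) / L * (real T * real T / 4) \<le> \<eta> T * (real T * (real T + 2) / 4)"
      using L T less_imp_le[OF \<eta>_pos[of T]] by (intro mult_mono) auto
    then show "real T / (36 * L) \<le> \<eta> T * (real T * (real T + 2) / 4)"
      using T by (simp add: field_simps)
  qed (use \<delta>_nonneg in simp)
  ultimately have "real T / (36 * L) * \<delta> T \<le> exp 6 * ((norm (x0 - xs))\<^sup>2 + s\<^sup>2)"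
    by linarith
  then have "\<delta> T \<le> 36 * L / real T * (exp 6 * ((norm (x0 - xs))\<^sup>2 + s\<^sup>2))"
    using L T by (simp add: field_simps)
  also have "\<dots> = 36 * exp 6 * (\<sigma>\<^sup>2 / L + L * (norm (x0 - xs))\<^sup>2) / real T"
  proof -
    have "\<sigma>\<^sup>2 / L + L * (norm (x0 - xs))\<^sup>2 = L * ((norm (x0 - xs))\<^sup>2 + s\<^sup>2)"
      using L by (simp add: s_def field_simps power2_eq_square)
    then show ?thesis by simp
  qed
  finally show ?thesis by (simp add: \<delta>_def x_def \<sigma>2)
qed

end

section \<open>The complexity bound on all coordinate spaces\<close>

theorem corollaryB2:
  shows "\<exists>C::real. C > 0 \<and>
    (\<forall>(d::nat) (n::nat) (L::real) (f :: nat \<Rightarrow> fseq \<Rightarrow> real) (xs::fseq) (x0::fseq)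
      (\<epsilon>::real) (T::nat) (\<pi> :: nat \<Rightarrow> nat \<Rightarrow> nat).
       L > 0 \<longrightarrow> n \<ge> 1 \<longrightarrow>
       (\<forall>i\<in>{1..n}. convex_on (rn d) (f i)) \<longrightarrow>
       (\<forall>i\<in>{1..n}. f i differentiable_on rn d) \<longrightarrow>
       (\<forall>i\<in>{1..n}. \<forall>x\<in>rn d. \<forall>y\<in>rn d.
          norm (grad_on (rn d) (f i) x - grad_on (rn d) (f i) y) \<le> L * norm (x - y)) \<longrightarrow>
       xs \<in> rn d \<longrightarrow> (\<forall>w\<in>rn d. avg n f xs \<le> avg n f w) \<longrightarrow>
       \<epsilon> > 0 \<longrightarrow> x0 \<in> rn d \<longrightarrow>
       (\<forall>t\<in>{1..T}. \<pi> t permutes {1..n}) \<longrightarrow>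
       T \<ge> 2 \<longrightarrow>
       (let \<sigma>2 = (\<Sum>i=1..n. (norm (grad_on (rn d) (f i) xs))\<^sup>2) / real n
        in real n * real T \<ge>
             C * (real n * \<sigma>2 / (L * \<epsilon>) + real n * L * (norm (x0 - xs))\<^sup>2 / \<epsilon>)) \<longrightarrow>
       (let xT = fst (nasg n (\<lambda>i. grad_on (rn d) (f i)) \<pi> momentum
                        (\<lambda>t i. epoch_rate L T t / real n) x0 x0 T)
        in avg n f xT - avg n f xs \<le> \<epsilon>))"
proof (intro exI[of _ "36 * exp 6"] conjI allI impI)
  fix d n :: nat and L \<epsilon> :: real and f :: "nat \<Rightarrow> fseq \<Rightarrow> real" and xs x0 :: fseq
    and T :: nat and \<pi> :: "nat \<Rightarrow> nat \<Rightarrow> nat"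
  define G where "G i = grad_on (rn d) (f i)" for i
  define \<sigma>2 where "\<sigma>2 = (\<Sum>i=1..n. (norm (G i xs))\<^sup>2) / real n"
  assume L: "L > 0" and n: "n \<ge> 1" and convex: "\<forall>i\<in>{1..n}. convex_on (rn d) (f i)"
    and diff: "\<forall>i\<in>{1..n}. f i differentiable_on rn d"
    and lip: "\<forall>i\<in>{1..n}. \<forall>x\<in>rn d. \<forall>y\<in>rn d.
          norm (grad_on (rn d) (f i) x - grad_on (rn d) (f i) y) \<le> L * norm (x - y)"
    and xs: "xs \<in> rn d" and min: "\<forall>w\<in>rn d. avg n f xs \<le> avg n f w"
    and \<epsilon>: "\<epsilon> > 0" and x0: "x0 \<in> rn d" and \<pi>: "\<forall>t\<in>{1..T}. \<pi> t permutes {1..n}" and T: "T \<ge> 2"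
    and budget: "let \<sigma>2 = (\<Sum>i=1..n. (norm (grad_on (rn d) (f i) xs))\<^sup>2) / real n
        in real n * real T \<ge>
          36 * exp 6 * (real n * \<sigma>2 / (L * \<epsilon>) + real n * L * (norm (x0 - xs))\<^sup>2 / \<epsilon>)"
  \<comment> \<open>Differentiability makes the \<open>THE\<close> in \<open>grad_on\<close> well
    defined, so its defining property is available.\<close>
  have G: "G i w \<in> rn d \<and> (f i has_derivative (\<lambda>h. inner (G i w) h)) (at w within rn d)"
    if "i \<in> {1..n}" "w \<in> rn d" for i w
    unfolding G_def grad_on_def
    by (rule theI'[OF grad_on_rn]) (use diff that in \<open>auto simp: differentiable_on_def\<close>)
  interpret convex_smooth_sum "rn d" f G L n
    by standard (use L n convex G lip subspace_rn in \<open>auto simp: G_def\<close>)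
  let ?xT = "fst (nasg n G \<pi> momentum (\<lambda>t i. epoch_rate L T t / real n) x0 x0 T)"
  have "36 * exp 6 * (real n * \<sigma>2 / (L * \<epsilon>) + real n * L * (norm (x0 - xs))\<^sup>2 / \<epsilon>)
      \<le> real n * real T"
    using budget by (simp only: Let_def \<sigma>2_def G_def)
  \<comment> \<open>Factoring out \<open>n\<close> turns the budget into the statement that the
    bound of \<open>nasg_bound\<close> is at most \<open>\<epsilon>\<close>; this dictates the
    absolute constant.\<close>
  also have "36 * exp 6 * (real n * \<sigma>2 / (L * \<epsilon>) + real n * L * (norm (x0 - xs))\<^sup>2 / \<epsilon>)
      = real n * (36 * exp 6 * (\<sigma>2 / L + L * (norm (x0 - xs))\<^sup>2) / \<epsilon>)"
    using L \<epsilon> by (simp add: field_simps)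
  finally have "36 * exp 6 * (\<sigma>2 / L + L * (norm (x0 - xs))\<^sup>2) / real T \<le> \<epsilon>"
    using n T \<epsilon> by (simp only: mult_le_cancel_left_pos of_nat_0_less_iff) (simp add: field_simps)
  moreover have "avg n f ?xT - avg n f xs
      \<le> 36 * exp 6 * (\<sigma>2 / L + L * (norm (x0 - xs))\<^sup>2) / real T"
    unfolding \<sigma>2_def using T \<pi> xs x0 min by (intro nasg_bound) auto
  moreover have "(\<lambda>i. grad_on (rn d) (f i)) = G" by (simp add: G_def fun_eq_iff)
  ultimately show "let xT = fst (nasg n (\<lambda>i. grad_on (rn d) (f i)) \<pi> momentum
                        (\<lambda>t i. epoch_rate L T t / real n) x0 x0 T)
        in avg n f xT - avg n f xs \<le> \<epsilon>"
    by (simp add: Let_def)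
qed simp

end
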